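(* Let $d\colon \Delta_{m-1}\times\Delta_{m-1}\to[0,\infty)$ be a continuous convex function and let $\Phi=\{\Phi^{(i)}\}_{i=1}^{L}$ be a finite data-independent partition of $A\subseteq\Delta_{m-1}$. Let $\hat\eta_d$ be the estimator of expected miscalibration computed from $(g(X_1),Y_1),\dots,(g(X_n),Y_n)$ with this fixed partition, and let $\eta_d$ be the expected miscalibration of $g$ on $A$ with respect to $d$. Then $$\lim_{n\to\infty}\hat\eta_d\le\eta_d,$$ with limit in the almost sure sense. Moreover, if $d$ can be written as $d(p,p')=f(p-p')$ for a convex function $f$, then equality holds if and only if for every $\Phi^{(i)}$ there exists a set $S\subseteq\mathbb{R}^m$ such that $\mathbb{P}[r(g(X))-g(X)\in S\mid g(X)\in\Phi^{(i)}]=1$ and $f$ coincides almost surely with an affine function on the convex hull of $S$.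
   Context: Setting. $(\Omega,\mathscr{F},\mathbb{P})$ is a probability space; $\mathcal{X}$ is the input space and $\mathcal{Y}$ is a finite set of $m$ class labels. $(X,Y),(X_1,Y_1),\dots,(X_n,Y_n)$ are i.i.d. random pairs with values in $\mathcal{X}\times\mathcal{Y}$. The set $\mathcal{P}(\mathcal{Y})$ of probability measures on $\mathcal{Y}$ is identified with the probability simplex $\Delta_{m-1}=\{x\in[0,1]^m:\|x\|_1=1\}$. A probabilistic classifier is a fixed (non-random) measurable map $g\colon\mathcal{X}\to\mathcal{P}(\mathcal{Y})$. Calibration function. $r(\mu):=\mathbb{P}[Y\in\cdot\mid g(X)=\mu]$ for every $\mu\in\mathcal{P}(\mathcal{Y})$ for which this is well-defined, so that $r(g(X))=\mathbb{P}[Y\in\cdot\mid g(X)]$. Expected miscalibration. For $A\subseteq\Delta_{m-1}$ and $d\colon\Delta_{m-1}\times\Delta_{m-1}\to[0,\infty)$, $$\eta_d:=\mathbb{E}[d(r(g(X)),g(X))\mid g(X)\in A].$$ Estimator. Let $\Phi=\{\Phi^{(i)}\}_{i=1}^{L}$ be a finite partition of $A$; data-independent means that it does not depend on the data $\{(g(X_j),Y_j)\}_{j=1}^n$, and it is kept fixed as $n$ grows. For the $n$ data points put $$\hat p^{(i)}:=\frac{|\{j: g(X_j)\in\Phi^{(i)}\}|}{|\{j: g(X_j)\in A\}|},\qquad \hat g^{(i)}:=\frac{\sum_{j:\,g(X_j)\in\Phi^{(i)}}g(X_j)}{|\{j: g(X_j)\in\Phi^{(i)}\}|},$$ $$\hat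 r^{(i)}(\{y\}):=\frac{|\{j: g(X_j)\in\Phi^{(i)},\ Y_j=y\}|}{|\{j: g(X_j)\in\Phi^{(i)}\}|}\quad(y\in\mathcal{Y}),$$ each being $0$ if its denominator is zero, and $$\hat\eta_d:=\sum_{i=1}^{L}\hat p^{(i)}\,d(\hat r^{(i)},\hat g^{(i)}).$$ *)

theory Defs
  imports "HOL-Probability.Probability"
begin

text \<open>
  Class labels are the elements of a finite type \<open>'y\<close> (so the number of labels is
  \<open>CARD('y)\<close>); probability measures on labels are vectors in \<open>real ^ 'y\<close>.
\<close>

definition prob_simplex :: "(real ^ 'y::finite) set" where
  "prob_simplex = {x. (\<forall>y. x $ y \<in> {0..1}) \<and> (\<Sum>y\<in>UNIV. \<bar>x $ y\<bar>) = 1}"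

abbreviation simplex_borel :: "(real ^ 'y::finite) measure" where
  "simplex_borel \<equiv> restrict_space borel prob_simplex"

text \<open>
  The pair \<open>(X, Y)\<close> together with all the pairs \<open>(Xs j, Ys j)\<close> is one i.i.d. family;
  the index \<open>None\<close> stands for \<open>(X, Y)\<close>. The first \<open>n\<close> data points are those with \<open>j < n\<close>.
\<close>

definition iid_data ::
  "'w measure \<Rightarrow> 'x measure \<Rightarrow> ('w \<Rightarrow> 'x) \<Rightarrow> ('w \<Rightarrow> 'y) \<Rightarrow> (nat \<Rightarrow> 'w \<Rightarrow> 'x) \<Rightarrow> (nat \<Rightarrow> 'w \<Rightarrow> 'y) \<Rightarrow> bool"
where
  "iid_data M MX X Y Xs Ys \<longleftrightarrow>
     prob_space.indep_vars M (\<lambda>_. MX \<Otimes>\<^sub>M count_space UNIV)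
       (case_option (\<lambda>\<omega>. (X \<omega>, Y \<omega>)) (\<lambda>j \<omega>. (Xs j \<omega>, Ys j \<omega>))) UNIV \<and>
     (\<forall>j. distr M (MX \<Otimes>\<^sub>M count_space UNIV) (\<lambda>\<omega>. (Xs j \<omega>, Ys j \<omega>)) =
          distr M (MX \<Otimes>\<^sub>M count_space UNIV) (\<lambda>\<omega>. (X \<omega>, Y \<omega>)))"

text \<open>
  \<open>r\<close> is a version of \<open>\<mu> \<mapsto> P[Y \<in> \<cdot> | g(X) = \<mu>]\<close>, i.e. a measurable map into the simplex such
  that \<open>r (g X)\<close> is the conditional distribution of \<open>Y\<close> given \<open>g X\<close>. The conditional
  probabilities determine \<open>r\<close> only up to null sets of the law of \<open>g X\<close>.
\<close>

definition calibration_function ::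
  "'w measure \<Rightarrow> ('x \<Rightarrow> real ^ 'y::finite) \<Rightarrow> ('w \<Rightarrow> 'x) \<Rightarrow> ('w \<Rightarrow> 'y) \<Rightarrow> (real ^ 'y \<Rightarrow> real ^ 'y) \<Rightarrow> bool"
where
  "calibration_function M g X Y r \<longleftrightarrow>
     r \<in> simplex_borel \<rightarrow>\<^sub>M simplex_borel \<and>
     (\<forall>y. AE \<omega> in M. r (g (X \<omega>)) $ y =
        real_cond_exp M (vimage_algebra (space M) (\<lambda>\<omega>. g (X \<omega>)) simplex_borel)
          (indicator {\<omega> \<in> space M. Y \<omega> = y}) \<omega>)"

text \<open>\<open>uniform_measure M E\<close> is the conditional measure \<open>P[\<cdot> | E]\<close>.\<close>

definition expected_miscalibration ::
  "'w measure \<Rightarrow> ('x \<Rightarrow> real ^ 'y::finite) \<Rightarrow> ('w \<Rightarrow> 'x) \<Rightarrow> (real ^ 'y \<Rightarrow> real ^ 'y) \<Rightarrow>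
   (real ^ 'y) set \<Rightarrow> ((real ^ 'y) \<times> (real ^ 'y) \<Rightarrow> real) \<Rightarrow> real"
where
  "expected_miscalibration M g X r A d =
     (\<integral>\<omega>. d (r (g (X \<omega>)), g (X \<omega>)) \<partial>uniform_measure M {\<omega> \<in> space M. g (X \<omega>) \<in> A})"

text \<open>
  In the estimators below, \<open>G j\<close> is the prediction and \<open>C j\<close> the label of the \<open>j\<close>-th data
  point. Quotients with denominator zero are zero, as required, by \<open>x / 0 = 0\<close>.
\<close>

definition bin_count :: "nat \<Rightarrow> (nat \<Rightarrow> 'v) \<Rightarrow> 'v set \<Rightarrow> nat" where
  "bin_count n G B = card {j. j < n \<and> G j \<in> B}"

definition p_hat :: "nat \<Rightarrow> (nat \<Rightarrow> 'v) \<Rightarrow> 'v set \<Rightarrow> 'v set \<Rightarrow> real" where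
  "p_hat n G A B = real (bin_count n G B) / real (bin_count n G A)"

definition g_hat :: "nat \<Rightarrow> (nat \<Rightarrow> real ^ 'y::finite) \<Rightarrow> (real ^ 'y) set \<Rightarrow> real ^ 'y" where
  "g_hat n G B = (\<Sum>j | j < n \<and> G j \<in> B. G j) /\<^sub>R real (bin_count n G B)"

definition r_hat :: "nat \<Rightarrow> (nat \<Rightarrow> 'v) \<Rightarrow> (nat \<Rightarrow> 'y) \<Rightarrow> 'v set \<Rightarrow> real ^ 'y::finite" where
  "r_hat n G C B =
     (\<chi> y. real (card {j. j < n \<and> G j \<in> B \<and> C j = y}) / real (bin_count n G B))"

definition miscalibration_estimator ::
  "(real ^ 'y::finite) set \<Rightarrow> (real ^ 'y) set set \<Rightarrow> ((real ^ 'y) \<times> (real ^ 'y) \<Rightarrow> real) \<Rightarrow>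
   nat \<Rightarrow> (nat \<Rightarrow> real ^ 'y) \<Rightarrow> (nat \<Rightarrow> 'y) \<Rightarrow> real"
where
  "miscalibration_estimator A \<Phi> d n G C =
     (\<Sum>B\<in>\<Phi>. p_hat n G A B * d (r_hat n G C B, g_hat n G B))"

end

theory Submission
  imports Defs
begin

text \<open>
  By the strong law of large numbers (Hoeffding's inequality and Borel--Cantelli, as all variables
  are bounded) the estimator converges almost surely to the sum over the bins \<open>B\<close> of
  \<open>P[g(X) \<in> B | g(X) \<in> A] d(E[r(g(X)) | g(X) \<in> B], E[g(X) | g(X) \<in> B])\<close>, and Jensen's inequality in
  each bin bounds this by the expected miscalibration. Equality holds iff Jensen's inequality is
  an equality in every bin of positive probability.

  Jensen's inequality and its equality case come from one fact: a random vector \<open>W\<close> with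
  values in a compact convex set lies almost surely in a compact convex subset \<open>K\<close> whose
  relative interior contains the mean of \<open>W\<close> (cut with supporting hyperplanes until the
  dimension is minimal). Apply it to \<open>W = (V, f(V))\<close> and the convex hull of the graph of \<open>f\<close>, which
  is contained in the epigraph. If the mean of \<open>W\<close> lies on the graph, then so does all of \<open>K\<close>,
  because each segment from a point of \<open>K\<close> to the mean can be prolonged within \<open>K\<close>. Hence \<open>f\<close> is
  affine on the projection of \<open>K\<close>, and no subgradient of \<open>f\<close> at a boundary point is needed.
\<close>

section \<open>Jensen's inequality and its equality case\<close>

lemma (in prob_space) mean_in_closed_convex:
  fixes W :: "'a \<Rightarrow> 'b::euclidean_space"
  assumes "integrable M W" "AE x in M. W x \<in> C" "convex C" "closed C"
  shows "expectation W \<in> C"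
proof (rule ccontr)
  assume "expectation W \<notin> C"
  then obtain a b where ab: "a \<bullet> expectation W < b" "\<forall>x\<in>C. a \<bullet> x > b"
    using separating_hyperplane_closed_point assms(3,4) by blast
  have "b \<le> expectation (\<lambda>x. a \<bullet> W x)"
    by (rule integral_ge_const) (use assms ab in \<open>auto elim!: AE_mp simp: less_imp_le\<close>)
  also have "\<dots> = a \<bullet> expectation W"
    using assms(1) by simp
  finally show False
    using ab by simp
qed

text \<open>Induction on the dimension of \<open>C\<close>. If the mean lies on the relative
  boundary, a supporting functional gives a nonnegative variable with mean zero. It vanishes almost
  surely, which confines \<open>W\<close> to a proper face of \<open>C\<close>, again compact and
  convex but of smaller dimension.\<close>

lemma (in prob_space) mean_in_rel_interior:
  fixes W :: "'a \<Rightarrow> 'b::euclidean_space"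
  assumes "integrable M W" "AE x in M. W x \<in> C" "convex C" "compact C"
  shows "\<exists>K\<subseteq>C. convex K \<and> compact K \<and> (AE x in M. W x \<in> K) \<and> expectation W \<in> rel_interior K"
  using assms(2-4)
proof (induction "nat (aff_dim C + 1)" arbitrary: C rule: less_induct)
  case less
  let ?m = "expectation W"
  have m: "?m \<in> C"
    using mean_in_closed_convex[OF assms(1)] less.prems compact_imp_closed by blast
  show ?case
  proof (cases "?m \<in> rel_interior C")
    case True
    with less.prems show ?thesis by blast
  next
    case False
    then obtain a where a: "a \<noteq> 0" "\<And>y. y \<in> C \<Longrightarrow> a \<bullet> ?m \<le> a \<bullet> y"
        "\<And>y. y \<in> rel_interior C \<Longrightarrow> a \<bullet> ?m < a \<bullet> y"
      using supporting_hyperplane_rel_boundary[OF \<open>convex C\<close> m] by metis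
    let ?F = "C \<inter> {x. a \<bullet> x = a \<bullet> ?m}"
    have face: "?F face_of C"
      using a less.prems by (intro face_of_Int_supporting_hyperplane_ge) auto
    have "rel_interior C \<noteq> {}"
      using m less.prems rel_interior_eq_empty by blast
    then obtain y where "y \<in> rel_interior C" by blast
    then have "y \<in> C" "y \<notin> ?F"
      using a(3)[of y] rel_interior_subset[of C] by auto
    then have "?F \<noteq> C" by blast
    then have lt: "aff_dim ?F < aff_dim C"
      using face_of_aff_dim_lt[OF \<open>convex C\<close> face] by blast
    have "AE x in M. 0 \<le> a \<bullet> W x - a \<bullet> ?m"
      using less.prems(1) by eventually_elim (simp add: a)
    moreover have "integrable M (\<lambda>x. a \<bullet> W x - a \<bullet> ?m)" "expectation (\<lambda>x. a \<bullet> W x - a \<bullet> ?m) = 0"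
      using assms(1) by (simp_all add: prob_space)
    ultimately have "AE x in M. a \<bullet> W x - a \<bullet> ?m = 0"
      using integral_nonneg_eq_0_iff_AE by blast
    with less.prems(1) have "AE x in M. W x \<in> ?F"
      by eventually_elim simp
    moreover have "convex ?F" "compact ?F"
      using face less.prems face_of_imp_convex face_of_imp_compact by blast+
    \<comment> \<open>\<open>aff_dim\<close> can be -1, for the empty set; the shift by one keeps
      \<open>nat\<close> strictly monotone down to that value.\<close>
    moreover have "nat (aff_dim ?F + 1) < nat (aff_dim C + 1)"
      using lt aff_dim_geq[of ?F] by linarith
    ultimately show ?thesis
      using less.hyps[of ?F] by blast
  qed
qed

text \<open>The epigraph is convex and contains the graph. The hull replaces it because the epigraph
  extends upwards without bound, whereas \<open>mean_in_rel_interior\<close> asks for a compact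
  set.\<close>

lemma graph_hull_subset_epigraph:
  assumes "convex_on D f"
  shows "convex hull ((\<lambda>x. (x, f x)) ` D) \<subseteq> epigraph D f"
  using assms convex_epigraph[of D f] convex_on_imp_convex[OF assms]
  by (intro hull_minimal) (auto simp: epigraph_def)

lemma compact_graph_hull:
  fixes f :: "'a::euclidean_space \<Rightarrow> real"
  assumes "continuous_on D f" "compact D"
  shows "compact (convex hull ((\<lambda>x. (x, f x)) ` D))"
  using assms by (intro compact_convex_hull compact_continuous_image continuous_intros)

lemma (in prob_space) integrable_in_compact:
  fixes V :: "'a \<Rightarrow> 'b::euclidean_space"
  assumes "V \<in> borel_measurable M" "AE x in M. V x \<in> D" "compact D"
  shows "integrable M V"
proof -
  obtain B where "\<And>x. x \<in> D \<Longrightarrow> norm x \<le> B"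
    using compact_imp_bounded[OF assms(3)] bounded_iff by metis
  with assms show ?thesis
    by (intro integrable_const_bound[of _ B]) (auto elim!: AE_mp)
qed

lemma (in prob_space) expectation_Pair_euclidean:
  fixes V :: "'a \<Rightarrow> 'b::euclidean_space" and F :: "'a \<Rightarrow> 'c::euclidean_space"
  assumes "integrable M V" "integrable M F"
  shows "expectation (\<lambda>x. (V x, F x)) = (expectation V, expectation F)"
proof -
  have "integrable M (\<lambda>x. (V x, F x))"
    using Bochner_Integration.integrable_add[OF
        integrable_bounded_linear[OF bounded_linear_Pair[OF bounded_linear_ident bounded_linear_zero] assms(1)]
        integrable_bounded_linear[OF bounded_linear_Pair[OF bounded_linear_zero bounded_linear_ident] assms(2)]]
    by simp
  then show ?thesis
    using integral_bounded_linear[OF bounded_linear_fst, of M "\<lambda>x. (V x, F x)"]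
      integral_bounded_linear[OF bounded_linear_snd, of M "\<lambda>x. (V x, F x)"]
    by (simp add: prod_eq_iff)
qed

text \<open>Common source of Jensen's inequality and of its equality case. Measurability of
  \<open>f (V x)\<close> is assumed separately: \<open>f\<close> is continuous on \<open>D\<close>
  only, and \<open>V\<close> may leave \<open>D\<close> on a null set.\<close>

lemma (in prob_space) graph_mean_in_rel_interior:
  fixes V :: "'a \<Rightarrow> 'b::euclidean_space" and f :: "'b \<Rightarrow> real"
  assumes V: "V \<in> borel_measurable M" "AE x in M. V x \<in> D"
    and fV: "(\<lambda>x. f (V x)) \<in> borel_measurable M"
    and D: "compact D" "continuous_on D f" "convex_on D f"
  obtains K where "convex K" "compact K" "K \<subseteq> epigraph D f" "AE x in M. (V x, f (V x)) \<in> K"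
    "(expectation V, expectation (\<lambda>x. f (V x))) \<in> rel_interior K"
proof -
  let ?C = "convex hull ((\<lambda>x. (x, f x)) ` D)"
  have AE: "AE x in M. (V x, f (V x)) \<in> ?C"
    using V(2) by eventually_elim (auto intro: hull_inc)
  have int: "integrable M V" "integrable M (\<lambda>x. f (V x))"
    by (rule integrable_in_compact[OF V D(1)],
      rule integrable_in_compact[OF fV _ compact_continuous_image[OF D(2,1)]])
      (use V(2) in \<open>eventually_elim, simp\<close>)
  have "integrable M (\<lambda>x. (V x, f (V x)))"
    by (rule integrable_in_compact[OF _ AE compact_graph_hull[OF D(2,1)]])
      (use V(1) fV in \<open>simp add: borel_prod[symmetric]\<close>)
  then obtain K where "K \<subseteq> ?C" "convex K" "compact K" "AE x in M. (V x, f (V x)) \<in> K"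
      "expectation (\<lambda>x. (V x, f (V x))) \<in> rel_interior K"
    using mean_in_rel_interior[OF _ AE _ compact_graph_hull[OF D(2,1)]] by auto
  with that graph_hull_subset_epigraph[OF D(3)] int show ?thesis
    by (simp add: expectation_Pair_euclidean)
qed

lemma (in prob_space) jensens_inequality_compact:
  fixes V :: "'a \<Rightarrow> 'b::euclidean_space" and f :: "'b \<Rightarrow> real"
  assumes "V \<in> borel_measurable M" "AE x in M. V x \<in> D"
    and "(\<lambda>x. f (V x)) \<in> borel_measurable M"
    and "compact D" "continuous_on D f" "convex_on D f"
  shows "f (expectation V) \<le> expectation (\<lambda>x. f (V x))"
proof -
  obtain K where "K \<subseteq> epigraph D f"
    "(expectation V, expectation (\<lambda>x. f (V x))) \<in> rel_interior K"
    using graph_mean_in_rel_interior[OF assms] .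
  then show ?thesis
    using rel_interior_subset[of K] by (auto simp: epigraph_def)
qed

text \<open>\<open>K\<close> lies in a hyperplane that is not vertical: its normal \<open>q\<close>
  is the component of \<open>(0, 1)\<close> orthogonal to all directions of \<open>K\<close>.
  Solving the hyperplane equation for the last coordinate gives the affine function.\<close>

lemma affine_on_convex_graph:
  fixes f :: "'a::euclidean_space \<Rightarrow> real"
  assumes K: "convex K" "z \<in> rel_interior K" and graph: "\<And>w. w \<in> K \<Longrightarrow> snd w = f (fst w)"
  shows "\<exists>a b. \<forall>x \<in> fst ` K. f x = a \<bullet> x + b"
proof -
  let ?L = "span ((\<lambda>w. - z + w) ` K)"
  have z: "z \<in> K"
    using K(2) rel_interior_subset by blast
  \<comment> \<open>A vertical direction in the affine hull would put two points over the same base point into \<open>K\<close>,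
    so some \<open>q = (a, c)\<close> with \<open>c \<noteq> 0\<close> is orthogonal to all directions of \<open>K\<close>.\<close>
  have vertical: "t = 0" if "(0, t) \<in> ?L" for t
  proof -
    have "z + (0, t) \<in> affine hull K"
      using that z by (auto simp: affine_hull_span_gen[OF hull_inc[OF z]])
    \<comment> \<open>As \<open>z\<close> is in the relative interior, the segment from
      \<open>z + (0, t)\<close> to \<open>z\<close> can be prolonged beyond \<open>z\<close> inside
      \<open>K\<close>. The new end point lies over the same base point as \<open>z\<close>, at
      height \<open>snd z + (1 - e) * t\<close>.\<close>
    then obtain e where e: "e > 1" "(1 - e) *\<^sub>R (z + (0, t)) + e *\<^sub>R z \<in> K"
      using K z convex_rel_interior_iff2[OF K(1), of z] by blast
    have "(1 - e) *\<^sub>R (z + (0, t)) + e *\<^sub>R z = z + (0, (1 - e) * t)"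
      by (simp add: algebra_simps prod_eq_iff)
    with e graph[of "z + (0, (1 - e) * t)"] graph[OF z]
    have "snd z + (1 - e) * t = f (fst z)" "snd z = f (fst z)"
      by auto
    with e show ?thesis by simp
  qed
  obtain p q where pq: "p \<in> ?L" "\<And>w. w \<in> ?L \<Longrightarrow> orthogonal q w" "(0::'a, 1::real) = p + q"
    using orthogonal_subspace_decomp_exists by metis
  have "q \<noteq> 0"
    using pq vertical[of 1] by auto
  obtain a c where q: "q = (a, c)" by fastforce
  \<comment> \<open>The left-hand side is the last coordinate \<open>c\<close> of \<open>q\<close>,
    and \<open>p\<close> contributes nothing because \<open>q\<close> is orthogonal to it; so
    \<open>c\<close> is the squared norm of \<open>q\<close>.\<close>
  have "q \<bullet> (0, 1) = q \<bullet> q"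
    using pq by (simp add: inner_add_right orthogonal_def)
  then have c: "c \<noteq> 0"
    using \<open>q \<noteq> 0\<close> q by (auto simp: zero_prod_def)
  have "f x = (- (1 / c) *\<^sub>R a) \<bullet> x + (q \<bullet> z) / c" if "x \<in> fst ` K" for x
  proof -
    obtain w where "w \<in> K" "x = fst w" using \<open>x \<in> fst ` K\<close> by auto
    then have "q \<bullet> (- z + w) = 0" "w = (x, f x)"
      using pq(2)[of "- z + w"] graph by (auto simp: orthogonal_def span_base prod_eq_iff)
    then have "a \<bullet> x + c * f x = q \<bullet> z"
      by (cases z) (simp add: q algebra_simps)
    then show ?thesis
      using c by (simp add: field_simps)
  qed
  then show ?thesis by blast
qed

text \<open>\<open>S\<close> is the projection of \<open>K\<close>, whose points all lie on the
  graph once the pair of means does. Convexity makes \<open>S\<close> its own convex hull and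
  compactness makes it Borel; \<open>d_bin_mean_eq_iff_affine\<close> uses both.\<close>

lemma (in prob_space) jensens_equality_affine:
  fixes V :: "'a \<Rightarrow> 'b::euclidean_space" and f :: "'b \<Rightarrow> real"
  assumes "V \<in> borel_measurable M" "AE x in M. V x \<in> D"
    and "(\<lambda>x. f (V x)) \<in> borel_measurable M"
    and "compact D" "continuous_on D f" "convex_on D f"
    and eq: "expectation (\<lambda>x. f (V x)) = f (expectation V)"
  obtains S a b where "convex S" "compact S" "AE x in M. V x \<in> S" "\<And>x. x \<in> S \<Longrightarrow> f x = a \<bullet> x + b"
proof -
  let ?m = "expectation V"
  obtain K where K: "convex K" "compact K" "K \<subseteq> epigraph D f" "AE x in M. (V x, f (V x)) \<in> K"
    and m: "(?m, f ?m) \<in> rel_interior K"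
    using graph_mean_in_rel_interior[OF assms(1-6)] unfolding eq .
  have "t = f x" if xt: "(x, t) \<in> K" for x t
  proof -
    \<comment> \<open>Prolong the segment from \<open>(x, t)\<close> through the mean to a point
      over \<open>x'\<close>. Convexity of \<open>f\<close> between \<open>x\<close> and
      \<open>x'\<close>, taken at the mean, then yields \<open>t \<le> f x\<close>, while
      \<open>f x \<le> t\<close> holds in the epigraph.\<close>
    obtain e where e: "e > 1" "(1 - e) *\<^sub>R (x, t) + e *\<^sub>R (?m, f ?m) \<in> K"
      using convex_rel_interior_iff[OF K(1)] xt m by blast
    define x' where "x' = (1 - e) *\<^sub>R x + e *\<^sub>R ?m"
    have x': "x' \<in> D" "f x' \<le> (1 - e) * t + e * f ?m" and x: "x \<in> D" "f x \<le> t"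
      using e K(3) xt by (auto simp: epigraph_def x'_def)
    have "?m = (1 - 1 / e) *\<^sub>R x + (1 / e) *\<^sub>R x'"
      using e(1) unfolding x'_def by (simp add: algebra_simps diff_divide_distrib)
    then have "f ?m \<le> (1 - 1 / e) * f x + (1 / e) * f x'"
      using convex_onD[OF assms(6), of "1 / e" x x'] e(1) x x' by simp
    then have "e * f ?m \<le> (e - 1) * f x + f x'"
      using e(1) by (simp add: field_simps)
    with x' have "(e - 1) * t \<le> (e - 1) * f x"
      by (simp add: algebra_simps)
    with e x show ?thesis by simp
  qed
  then have "\<exists>a b. \<forall>x\<in>fst ` K. f x = a \<bullet> x + b"
    by (intro affine_on_convex_graph[OF K(1) m]) auto
  moreover have "convex (fst ` K)" "compact (fst ` K)"
    using K convex_linear_image[OF linear_fst K(1)]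
      compact_continuous_image[OF continuous_on_fst[OF continuous_on_id] K(2)] by auto
  moreover have "AE x in M. V x \<in> fst ` K"
    using K(4) by eventually_elim force
  ultimately show ?thesis
    using that by blast
qed

lemma (in prob_space) jensens_equality_if_affine:
  fixes V :: "'a \<Rightarrow> 'b::euclidean_space" and f :: "'b \<Rightarrow> real"
  assumes V: "V \<in> borel_measurable M" "AE x in M. V x \<in> D"
    and D: "compact D" "continuous_on D f" "convex D"
    and fV: "(\<lambda>x. f (V x)) \<in> borel_measurable M"
    and S: "AE x in M. V x \<in> S" "\<And>x. x \<in> convex hull S \<Longrightarrow> f x = a \<bullet> x + b"
  shows "expectation (\<lambda>x. f (V x)) = f (expectation V)"
proof -
  \<comment> \<open>\<open>S\<close> may leave \<open>D\<close> and the mean is only known to lie in the closure of the hull, where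
    \<open>f\<close> is still affine by continuity.\<close>
  let ?T = "convex hull (S \<inter> D)"
  have int: "integrable M V"
    by (rule integrable_in_compact[OF V D(1)])
  have sub: "closure ?T \<subseteq> D"
    using D by (intro closure_minimal hull_minimal compact_imp_closed) auto
  have f: "f x = a \<bullet> x + b" if "x \<in> closure ?T" for x
  proof -
    have "closed {x \<in> D. f x = a \<bullet> x + b}"
      using continuous_closed_preimage[OF _ compact_imp_closed[OF D(1)] closed_singleton[of 0],
          of "\<lambda>x. f x - (a \<bullet> x + b)"] D(2)
      by (simp add: vimage_def Int_def continuous_intros)
    moreover have "?T \<subseteq> {x \<in> D. f x = a \<bullet> x + b}"
      using S(2) hull_mono[of "S \<inter> D" S convex] closure_subset sub by blast
    ultimately show ?thesis
      using that closure_minimal by blast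
  qed
  have AE: "AE x in M. V x \<in> closure ?T"
    using V(2) S(1) by eventually_elim (simp add: closure_subset[THEN subsetD] hull_inc)
  have "expectation (\<lambda>x. f (V x)) = expectation (\<lambda>x. a \<bullet> V x + b)"
    by (rule integral_cong_AE) (use fV V f AE in \<open>auto elim!: AE_mp\<close>)
  also have "\<dots> = a \<bullet> expectation V + b"
    using int by (simp add: prob_space)
  also have "\<dots> = f (expectation V)"
    using f mean_in_closed_convex[OF int AE] by (simp add: convex_closure)
  finally show ?thesis .
qed

text \<open>Transfers continuity from \<open>d (p, p') = f (p - p')\<close> to \<open>f\<close>. A
  continuous map from a compact set to a Hausdorff space is closed, so the preimage of
  \<open>C\<close> under \<open>f\<close> is the closed image of its preimage under the
  composition.\<close>

lemma continuous_on_compact_quotient: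
  fixes q :: "'a::topological_space \<Rightarrow> 'b::t2_space" and f :: "'b \<Rightarrow> 'c::topological_space"
  assumes "compact T" "continuous_on T q" "continuous_on T (\<lambda>x. f (q x))"
  shows "continuous_on (q ` T) f"
proof -
  have "closed (f -` C \<inter> q ` T)" if "closed C" for C
  proof -
    obtain U where U: "closed U" "U \<inter> T = (\<lambda>x. f (q x)) -` C \<inter> T"
      using assms(3) \<open>closed C\<close> unfolding continuous_on_closed_invariant by blast
    then have "f -` C \<inter> q ` T = q ` (U \<inter> T)" by auto
    moreover have "compact (q ` (U \<inter> T))"
      using assms U(1) by (intro compact_continuous_image closed_Int_compact)
        (auto intro: continuous_on_subset)
    ultimately show ?thesis
      by (simp add: compact_imp_closed)
  qed
  then show ?thesis
    using continuous_on_closed_vimage[of "q ` T" f] compact_continuous_image[OF assms(2,1)]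
    by (simp add: compact_imp_closed)
qed

section \<open>The strong law of large numbers for bounded variables\<close>

text \<open>Injectivity makes the blocks \<open>{f i}\<close> disjoint, hence independent, and each
  block is read off at its only coordinate. Serves to renumber the data points \<open>Some j\<close>
  by \<open>j\<close>.\<close>

lemma (in prob_space) indep_vars_reindex_inj:
  assumes "indep_vars M' Z (f ` I)" "inj_on f I"
  shows "indep_vars (\<lambda>i. M' (f i)) (\<lambda>i. Z (f i)) I"
proof -
  have "indep_vars (\<lambda>i. PiM {f i} M') (\<lambda>i \<omega>. restrict (\<lambda>j. Z j \<omega>) {f i}) I"
    using assms by (intro indep_vars_restrict) (auto simp: disjoint_family_on_def inj_on_def)
  then have "indep_vars (\<lambda>i. M' (f i)) (\<lambda>i \<omega>. (\<lambda>z. z (f i)) (restrict (\<lambda>j. Z j \<omega>) {f i})) I"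
    by (rule indep_vars_compose2) (auto intro: measurable_component_singleton)
  then show ?thesis by simp
qed

text \<open>For fixed \<open>e\<close>, Hoeffding's bound decays geometrically in \<open>n\<close>,
  hence is summable, and Borel--Cantelli applies. The countably many values
  \<open>1 / (k + 1)\<close> of \<open>e\<close> suffice. \<open>W\<close> stands for the common
  law.\<close>

lemma (in prob_space) strong_law_bounded:
  fixes Z :: "nat \<Rightarrow> 'a \<Rightarrow> real"
  assumes indep: "indep_vars (\<lambda>_. borel) Z UNIV"
    and distr: "\<And>j. distr M borel (Z j) = distr M borel W"
    and W: "random_variable borel W" "AE \<omega> in M. \<bar>W \<omega>\<bar> \<le> c"
  shows "AE \<omega> in M. (\<lambda>n. (\<Sum>j<n. Z j \<omega>) / real n) \<longlonglongrightarrow> expectation W"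
proof -
  define \<mu> where "\<mu> = expectation W"
  \<comment> \<open>Strictly positive even for \<open>c = 0\<close>, so that the interval from
    \<open>- a\<close> to \<open>a\<close> is not degenerate and the rate \<open>?k\<close> below is
    positive.\<close>
  define a where "a = \<bar>c\<bar> + 1"
  have Z [measurable]: "random_variable borel (Z j)" for j
    using indep by (auto simp: indep_vars_def)
  have close: "AE \<omega> in M. \<forall>\<^sub>F n in sequentially. \<bar>(\<Sum>j<n. Z j \<omega>) / real n - \<mu>\<bar> < e" if e: "e > 0" for e
  proof -
    let ?E = "\<lambda>n. {\<omega> \<in> space M. \<bar>(\<Sum>j<n. Z j \<omega>) / real n - \<mu>\<bar> \<ge> e}"
    let ?k = "2 * e\<^sup>2 / (a - (- a))\<^sup>2"
    have k: "?k > 0"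
      using e by (simp add: a_def)
    have bound: "prob (?E n) \<le> 2 * exp (- ?k) ^ n" if n: "n \<ge> 1" for n
    proof -
      interpret Hoeffding_ineq_iid M "{..<n}" Z W "- a" a \<mu>
        unfolding \<mu>_def
      proof unfold_locales
        show "indep_vars (\<lambda>_. borel) Z {..<n}"
          by (rule indep_vars_subset[OF indep]) simp
        show "AE x in M. W x \<in> {- a..a}"
          using W(2) by eventually_elim (auto simp: a_def)
      qed (simp_all add: distr W)
      have "prob (?E n) \<le> 2 * exp (- 2 * real (card {..<n}) * e\<^sup>2 / (a - (- a))\<^sup>2)"
        using Hoeffding_ineq_abs_ge'[of e] e n by (auto simp: a_def lessThan_empty_iff)
      also have "exp (- 2 * real (card {..<n}) * e\<^sup>2 / (a - (- a))\<^sup>2) = exp (- ?k) ^ n"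
        by (simp add: exp_of_nat_mult[symmetric] mult_ac)
      finally show ?thesis .
    qed
    have "AE \<omega> in M. \<forall>\<^sub>F n in sequentially. \<omega> \<in> space M - ?E n"
    proof (rule borel_cantelli_AE1)
      have "summable (\<lambda>n. 2 * exp (- ?k) ^ n)"
        using k by (intro summable_mult summable_geometric) simp
      then show "summable (\<lambda>n. prob (?E n))"
        by (rule summable_comparison_test') (use bound in auto)
    qed (auto simp: emeasure_eq_measure)
    then show ?thesis
      by eventually_elim (auto elim!: eventually_mono)
  qed
  have "AE \<omega> in M. \<forall>k. \<forall>\<^sub>F n in sequentially. \<bar>(\<Sum>j<n. Z j \<omega>) / real n - \<mu>\<bar> < inverse (real (Suc k))"
    by (subst AE_all_countable) (auto intro: close)
  then show ?thesis
  proof eventually_elim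
    case (elim \<omega>)
    show ?case
    proof (rule tendstoI)
      fix e :: real assume "e > 0"
      then obtain k where "inverse (real (Suc k)) < e"
        using reals_Archimedean by blast
      with elim[rule_format, of k]
      show "\<forall>\<^sub>F n in sequentially. dist ((\<Sum>j<n. Z j \<omega>) / real n) (expectation W) < e"
        by (auto simp: dist_real_def \<mu>_def elim!: eventually_mono)
    qed
  qed
qed

section \<open>Averages over an i.i.d. sample\<close>

lemma (in prob_space) iid_data_random_variables:
  assumes "iid_data M MX X Y Xs Ys"
  shows "(\<lambda>\<omega>. (X \<omega>, Y \<omega>)) \<in> M \<rightarrow>\<^sub>M MX \<Otimes>\<^sub>M count_space UNIV"
    and "(\<lambda>\<omega>. (Xs j \<omega>, Ys j \<omega>)) \<in> M \<rightarrow>\<^sub>M MX \<Otimes>\<^sub>M count_space UNIV"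
proof -
  have *: "random_variable (MX \<Otimes>\<^sub>M count_space UNIV)
      (case_option (\<lambda>\<omega>. (X \<omega>, Y \<omega>)) (\<lambda>j \<omega>. (Xs j \<omega>, Ys j \<omega>)) i)" for i
    using assms unfolding iid_data_def indep_vars_def by blast
  show "(\<lambda>\<omega>. (X \<omega>, Y \<omega>)) \<in> M \<rightarrow>\<^sub>M MX \<Otimes>\<^sub>M count_space UNIV"
    "(\<lambda>\<omega>. (Xs j \<omega>, Ys j \<omega>)) \<in> M \<rightarrow>\<^sub>M MX \<Otimes>\<^sub>M count_space UNIV"
    using *[of None] *[of "Some j"] by simp_all
qed

lemma (in prob_space) iid_data_average_tendsto:
  assumes iid: "iid_data M MX X Y Xs Ys"
    and h: "h \<in> borel_measurable (MX \<Otimes>\<^sub>M count_space UNIV)"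
    and bound: "\<And>x y. x \<in> space MX \<Longrightarrow> \<bar>h (x, y)\<bar> \<le> (c::real)"
  shows "AE \<omega> in M. (\<lambda>n. (\<Sum>j<n. h (Xs j \<omega>, Ys j \<omega>)) / real n) \<longlonglongrightarrow> expectation (\<lambda>\<omega>. h (X \<omega>, Y \<omega>))"
proof (rule strong_law_bounded)
  let ?N = "MX \<Otimes>\<^sub>M count_space UNIV"
  note rv = iid_data_random_variables[OF iid]
  have "indep_vars (\<lambda>_. ?N) (case_option (\<lambda>\<omega>. (X \<omega>, Y \<omega>)) (\<lambda>j \<omega>. (Xs j \<omega>, Ys j \<omega>))) (range Some)"
    using iid indep_vars_subset unfolding iid_data_def by blast
  from indep_vars_reindex_inj[OF this inj_Some]
  have "indep_vars (\<lambda>_. ?N) (\<lambda>j \<omega>. (Xs j \<omega>, Ys j \<omega>)) UNIV"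
    by simp
  then show "indep_vars (\<lambda>_. borel) (\<lambda>j \<omega>. h (Xs j \<omega>, Ys j \<omega>)) UNIV"
    by (rule indep_vars_compose2) (use h in simp)
  show "distr M borel (\<lambda>\<omega>. h (Xs j \<omega>, Ys j \<omega>)) = distr M borel (\<lambda>\<omega>. h (X \<omega>, Y \<omega>))" for j
    using iid distr_distr[OF h rv(1)] distr_distr[OF h rv(2)[of j]]
    by (simp add: iid_data_def comp_def)
  show "random_variable borel (\<lambda>\<omega>. h (X \<omega>, Y \<omega>))"
    using measurable_compose[OF rv(1) h] .
  show "AE \<omega> in M. \<bar>h (X \<omega>, Y \<omega>)\<bar> \<le> c"
    using measurable_space[OF rv(1)] by (intro AE_I2 bound) (auto simp: space_pair_measure)
qed

section \<open>Conditioning on an event\<close>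

text \<open>The factor \<open>prob E\<close> stands on the left so that the identity covers null
  events too, where both sides are zero. Otherwise the conditional measure has density
  \<open>indicator E x / prob E\<close>.\<close>

lemma (in prob_space) integral_uniform_measure:
  fixes f :: "'a \<Rightarrow> 'b::{banach, second_countable_topology}"
  assumes f: "f \<in> borel_measurable M" and E: "E \<in> events"
  shows "prob E *\<^sub>R (\<integral>x. f x \<partial>uniform_measure M E) = (\<integral>x. indicator E x *\<^sub>R f x \<partial>M)"
proof (cases "prob E = 0")
  case True
  then have "AE x in M. x \<notin> E"
    using E by (simp add: AE_iff_null_sets[symmetric] null_setsI emeasure_eq_measure)
  then have "(\<integral>x. indicator E x *\<^sub>R f x \<partial>M) = (\<integral>x. 0 \<partial>M)"
    using f E by (intro integral_cong_AE) (auto elim!: AE_mp simp: indicator_def)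
  with True show ?thesis by simp
next
  case False
  then have "uniform_measure M E = density M (\<lambda>x. ennreal (indicator E x / prob E))"
    unfolding uniform_measure_def using zero_less_measure_iff[of M E]
    by (intro density_cong) (use E in \<open>auto simp: emeasure_eq_measure indicator_def
      divide_ennreal[symmetric] zero_less_measure_iff\<close>)
  then have "(\<integral>x. f x \<partial>uniform_measure M E) = (\<integral>x. (indicator E x / prob E) *\<^sub>R f x \<partial>M)"
    using f E by (simp add: integral_density)
  also have "\<dots> = (\<integral>x. (1 / prob E) *\<^sub>R indicator E x *\<^sub>R f x \<partial>M)"
    by simp
  also have "\<dots> = (1 / prob E) *\<^sub>R (\<integral>x. indicator E x *\<^sub>R f x \<partial>M)"
    by (rule integral_scaleR_right)
  finally show ?thesis
    using False by simp
qed

text \<open>Handles the arbitrary set \<open>S\<close> of the theorem: no measurability of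
  \<open>P\<close> is assumed, it is recovered from the value 1.\<close>

lemma (in prob_space) AE_uniform_measure_if_cond_prob_eq_1:
  assumes Q: "{x \<in> space M. Q x} \<in> events" "prob {x \<in> space M. Q x} > 0"
    and 1: "cond_prob M P Q = 1"
  shows "AE x in uniform_measure M {x \<in> space M. Q x}. P x"
proof -
  have eq: "prob {x \<in> space M. P x \<and> Q x} = prob {x \<in> space M. Q x}"
    using 1 Q by (simp add: cond_prob_def)
  \<comment> \<open>A non-measurable set would have measure 0.\<close>
  with Q have ev: "{x \<in> space M. P x \<and> Q x} \<in> events"
    using measure_notin_sets by fastforce
  have "prob ({x \<in> space M. Q x} - {x \<in> space M. P x \<and> Q x}) = 0"
    using eq ev Q by (subst finite_measure_Diff) auto
  then have "AE x in M. x \<notin> {x \<in> space M. Q x} - {x \<in> space M. P x \<and> Q x}"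
    using ev Q by (intro AE_not_in null_setsI) (auto simp: emeasure_eq_measure)
  then show ?thesis
    using Q by (intro AE_uniform_measureI) (auto elim!: AE_mp)
qed

lemma (in prob_space) cond_prob_eq_1_if_AE_uniform_measure:
  assumes Q: "{x \<in> space M. Q x} \<in> events" "prob {x \<in> space M. Q x} > 0"
    and P: "{x \<in> space M. P x} \<in> events" "AE x in uniform_measure M {x \<in> space M. Q x}. P x"
  shows "cond_prob M P Q = 1"
proof -
  have "AE x in M. Q x \<longrightarrow> P x"
    using P(2) Q by (subst (asm) AE_uniform_measure) (auto simp: emeasure_eq_measure elim!: AE_mp)
  then have "prob {x \<in> space M. P x \<and> Q x} = prob {x \<in> space M. Q x}"
    using P(1) Q(1) by (intro finite_measure_eq_AE) (auto intro: sets.sets_Collect_conj)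
  with Q show ?thesis
    by (simp add: cond_prob_def)
qed

section \<open>The simplex and the empirical bin averages\<close>

lemma prob_simplex_iff: "x \<in> prob_simplex \<longleftrightarrow> (\<forall>y. 0 \<le> x $ y) \<and> (\<Sum>y\<in>UNIV. x $ y) = 1"
proof
  assume *: "(\<forall>y. 0 \<le> x $ y) \<and> (\<Sum>y\<in>UNIV. x $ y) = 1"
  then have "x $ y \<le> 1" for y
    using member_le_sum[of y UNIV "\<lambda>y. x $ y"] by auto
  with * show "x \<in> prob_simplex"
    by (simp add: prob_simplex_def)
next
  assume *: "x \<in> prob_simplex"
  then have "\<forall>y. 0 \<le> x $ y" "(\<Sum>y\<in>UNIV. \<bar>x $ y\<bar>) = 1"
    unfolding prob_simplex_def by auto
  then show "(\<forall>y. 0 \<le> x $ y) \<and> (\<Sum>y\<in>UNIV. x $ y) = 1"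
    by simp
qed

lemma convex_prob_simplex: "convex prob_simplex"
  by (auto simp: convex_def prob_simplex_iff sum.distrib sum_distrib_left[symmetric])

lemma compact_prob_simplex: "compact (prob_simplex :: (real ^ 'y::finite) set)"
proof -
  have "bounded (prob_simplex :: (real ^ 'y) set)"
    unfolding bounded_iff by (intro exI[of _ 1] ballI order_trans[OF norm_le_l1_cart])
      (simp add: prob_simplex_iff)
  moreover have "closed {x :: real ^ 'y. (\<forall>y. 0 \<le> x $ y) \<and> (\<Sum>y\<in>UNIV. x $ y) = 1}"
    by (intro closed_Collect_conj closed_Collect_all closed_Collect_le closed_Collect_eq continuous_intros)
  then have "closed (prob_simplex :: (real ^ 'y) set)"
    by (simp add: prob_simplex_iff[symmetric])
  ultimately show ?thesis
    by (simp add: compact_eq_bounded_closed)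
qed

section \<open>Estimators as quotients of sums over the sample\<close>

text \<open>A sum of one function evaluated at the data points is the form to which the strong law
  applies; the next two lemmas bring the coordinates of the estimators into it.\<close>

lemma bin_count_eq_sum: "real (bin_count n G B) = (\<Sum>j<n. indicator B (G j))"
  unfolding bin_count_def indicator_def of_bool_def
  by (subst sum.inter_filter[symmetric]) (auto intro!: arg_cong[where f=card])

lemma g_hat_nth: "g_hat n G B $ y = (\<Sum>j<n. indicator B (G j) * G j $ y) / real (bin_count n G B)"
proof -
  have "(\<Sum>j | j < n \<and> G j \<in> B. G j $ y) = (\<Sum>j<n. if G j \<in> B then G j $ y else 0)"
    by (subst sum.inter_filter[symmetric]) (auto intro: sum.cong)
  also have "\<dots> = (\<Sum>j<n. indicator B (G j) * G j $ y)"
    by (intro sum.cong) (auto simp: indicator_def)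
  finally show ?thesis
    by (simp add: g_hat_def divide_inverse_commute)
qed

lemma r_hat_nth:
  "r_hat n G C B $ y = (\<Sum>j<n. indicator B (G j) * indicator {y} (C j)) / real (bin_count n G B)"
proof -
  have "real (card {j. j < n \<and> G j \<in> B \<and> C j = y}) = (\<Sum>j<n. if G j \<in> B \<and> C j = y then 1 else 0)"
    by (subst sum.inter_filter[symmetric]) (auto intro!: arg_cong[where f=card])
  also have "\<dots> = (\<Sum>j<n. indicator B (G j) * indicator {y} (C j))"
    by (intro sum.cong) (auto simp: indicator_def)
  finally show ?thesis
    by (simp add: r_hat_def)
qed

text \<open>An empty bin has to be excluded because its estimate is the zero vector, which is
  outside the simplex. The same holds for \<open>r_hat\<close> below.\<close>

lemma g_hat_in_prob_simplex:
  assumes "bin_count n G B \<noteq> 0" "\<And>j. G j \<in> prob_simplex"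
  shows "g_hat n G B \<in> prob_simplex"
proof -
  have "(\<Sum>y\<in>UNIV. \<Sum>j<n. indicator B (G j) * G j $ y) = (\<Sum>j<n. indicator B (G j) * (\<Sum>y\<in>UNIV. G j $ y))"
    by (subst sum.swap) (simp add: sum_distrib_left)
  then show ?thesis
    using assms unfolding prob_simplex_iff
    by (auto simp: g_hat_nth sum_divide_distrib[symmetric] bin_count_eq_sum[symmetric]
        intro!: divide_nonneg_nonneg sum_nonneg)
qed

lemma r_hat_in_prob_simplex:
  fixes C :: "nat \<Rightarrow> 'y::finite"
  assumes "bin_count n G B \<noteq> 0"
  shows "r_hat n G C B \<in> prob_simplex"
proof -
  have "(\<Sum>y\<in>UNIV. \<Sum>j<n. indicator B (G j) * indicator {y} (C j)) = (\<Sum>j<n. indicator B (G j) * (\<Sum>y\<in>UNIV. indicator {y} (C j) :: real))"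
    by (subst sum.swap) (simp only: sum_distrib_left)
  moreover have "(\<Sum>y\<in>UNIV. indicator {y} z) = (1::real)" for z :: 'y
    by (simp add: indicator_def)
  ultimately show ?thesis
    using assms unfolding prob_simplex_iff
    by (auto simp: r_hat_nth sum_divide_distrib[symmetric] bin_count_eq_sum[symmetric]
        intro!: divide_nonneg_nonneg sum_nonneg)
qed

section \<open>Limits in a fixed bin\<close>

locale calibrated_data = prob_space M
  for M :: "'w measure" and MX :: "'x measure"
    and X :: "'w \<Rightarrow> 'x" and Y :: "'w \<Rightarrow> 'y::finite"
    and Xs :: "nat \<Rightarrow> 'w \<Rightarrow> 'x" and Ys :: "nat \<Rightarrow> 'w \<Rightarrow> 'y"
    and g :: "'x \<Rightarrow> real ^ 'y" and r :: "real ^ 'y \<Rightarrow> real ^ 'y" +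
  assumes iid: "iid_data M MX X Y Xs Ys"
    and g: "g \<in> MX \<rightarrow>\<^sub>M simplex_borel"
    and calibration: "calibration_function M g X Y r"
begin

definition bin :: "(real ^ 'y) set \<Rightarrow> 'w set" where
  "bin B = {\<omega> \<in> space M. g (X \<omega>) \<in> B}"

text \<open>The value type is general because vectors, pairs of vectors and values of
  \<open>d\<close> are averaged. On a null bin the mean carries no information and enters only with
  weight zero.\<close>

definition bin_mean :: "(real ^ 'y) set \<Rightarrow> ('w \<Rightarrow> 'v::{banach, second_countable_topology}) \<Rightarrow> 'v" where
  "bin_mean B f = (\<integral>\<omega>. f \<omega> \<partial>uniform_measure M (bin B))"

lemma g_in_prob_simplex: "x \<in> space MX \<Longrightarrow> g x \<in> prob_simplex"
  using measurable_space[OF g] by (simp add: space_restrict_space)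

lemma measurable_g [measurable]: "g \<in> borel_measurable MX"
  using g by (simp add: measurable_restrict_space2_iff)

lemma X_in_space [simp]: "\<omega> \<in> space M \<Longrightarrow> X \<omega> \<in> space MX"
  and Xs_in_space [simp]: "\<omega> \<in> space M \<Longrightarrow> Xs j \<omega> \<in> space MX"
  using measurable_space[OF iid_data_random_variables(1)[OF iid]]
    measurable_space[OF iid_data_random_variables(2)[OF iid, of j]]
  by (auto simp: space_pair_measure)

lemma measurable_X [measurable]: "X \<in> M \<rightarrow>\<^sub>M MX"
  and measurable_Y [measurable]: "Y \<in> M \<rightarrow>\<^sub>M count_space UNIV"
  using measurable_compose[OF iid_data_random_variables(1)[OF iid] measurable_fst]
    measurable_compose[OF iid_data_random_variables(1)[OF iid] measurable_snd] by simp_all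

lemma measurable_gX [measurable]: "(\<lambda>\<omega>. g (X \<omega>)) \<in> borel_measurable M"
  by measurable

lemma measurable_gX_simplex: "(\<lambda>\<omega>. g (X \<omega>)) \<in> M \<rightarrow>\<^sub>M simplex_borel"
  using measurable_compose[OF measurable_X g] .

lemma measurable_rgX_simplex: "(\<lambda>\<omega>. r (g (X \<omega>))) \<in> M \<rightarrow>\<^sub>M simplex_borel"
  using measurable_compose[OF measurable_gX_simplex] calibration
  unfolding calibration_function_def by blast

lemma measurable_rgX [measurable]: "(\<lambda>\<omega>. r (g (X \<omega>))) \<in> borel_measurable M"
  using measurable_rgX_simplex by (simp add: measurable_restrict_space2_iff)

lemma gX_in_prob_simplex: "\<omega> \<in> space M \<Longrightarrow> g (X \<omega>) \<in> prob_simplex"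
  by (simp add: g_in_prob_simplex)

lemma rgX_in_prob_simplex: "\<omega> \<in> space M \<Longrightarrow> r (g (X \<omega>)) \<in> prob_simplex"
  using measurable_space[OF measurable_rgX_simplex] by (simp add: space_restrict_space)

lemma bin_in_events [measurable]: "B \<in> sets borel \<Longrightarrow> bin B \<in> events"
  using measurable_sets[OF measurable_gX, of B] by (simp add: bin_def vimage_def Int_def conj_commute)

lemma prob_times_bin_mean:
  fixes f :: "'w \<Rightarrow> 'v::{banach, second_countable_topology}"
  assumes "B \<in> sets borel" "f \<in> borel_measurable M"
  shows "prob (bin B) *\<^sub>R bin_mean B f = expectation (\<lambda>\<omega>. indicator B (g (X \<omega>)) *\<^sub>R f \<omega>)"
proof -
  have "prob (bin B) *\<^sub>R bin_mean B f = expectation (\<lambda>\<omega>. indicator (bin B) \<omega> *\<^sub>R f \<omega>)"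
    unfolding bin_mean_def using assms by (intro integral_uniform_measure bin_in_events)
  also have "\<dots> = expectation (\<lambda>\<omega>. indicator B (g (X \<omega>)) *\<^sub>R f \<omega>)"
    by (intro Bochner_Integration.integral_cong) (auto simp: bin_def indicator_def)
  finally show ?thesis .
qed

lemma prob_bin_eq_expectation:
  assumes "B \<in> sets borel"
  shows "prob (bin B) = expectation (\<lambda>\<omega>. indicator B (g (X \<omega>)))"
proof -
  have "prob (bin B) = expectation (indicator (bin B))"
    using assms by simp
  also have "\<dots> = expectation (\<lambda>\<omega>. indicator B (g (X \<omega>)))"
    by (intro Bochner_Integration.integral_cong) (auto simp: bin_def indicator_def)
  finally show ?thesis .
qed

text \<open>This is where \<open>r\<close> acts as a conditional distribution: \<open>bin B\<close>
  belongs to the sigma-algebra generated by \<open>g (X \<omega>)\<close>, and over such events the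
  indicator of \<open>Y \<omega> = y\<close> and its conditional expectation have equal
  integrals.\<close>

lemma label_frequency_eq_calibration:
  assumes B: "B \<in> sets borel"
  shows "expectation (\<lambda>\<omega>. indicator B (g (X \<omega>)) * indicator {y} (Y \<omega>)) =
    expectation (\<lambda>\<omega>. indicator B (g (X \<omega>)) * r (g (X \<omega>)) $ y)"
proof -
  let ?F = "vimage_algebra (space M) (\<lambda>\<omega>. g (X \<omega>)) simplex_borel"
  let ?f = "indicator {\<omega> \<in> space M. Y \<omega> = y} :: 'w \<Rightarrow> real"
  have "subalgebra M ?F"
    using measurable_gX_simplex by (simp add: subalgebra_def measurable_iff_sets)
  then interpret finite_measure_subalgebra M ?F
    by unfold_locales
  have [measurable]: "{\<omega> \<in> space M. Y \<omega> = y} \<in> events"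
    by measurable
  \<comment> \<open>The sigma-algebra is pulled back from \<open>simplex_borel\<close>, so
    \<open>B\<close> is first cut down to its trace on the simplex; since \<open>g\<close> takes
    values there, the preimage is still \<open>bin B\<close>.\<close>
  have "(\<lambda>\<omega>. g (X \<omega>)) -` (prob_simplex \<inter> B) \<inter> space M \<in> sets ?F"
    using B by (intro in_vimage_algebra) (auto simp: sets_restrict_space)
  moreover have "(\<lambda>\<omega>. g (X \<omega>)) -` (prob_simplex \<inter> B) \<inter> space M = bin B"
    using gX_in_prob_simplex by (auto simp: bin_def)
  ultimately have binF: "bin B \<in> sets ?F" by simp
  have "expectation (\<lambda>\<omega>. indicator B (g (X \<omega>)) * indicator {y} (Y \<omega>)) =
      expectation (\<lambda>\<omega>. indicator (bin B) \<omega> *\<^sub>R ?f \<omega>)"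
    by (intro Bochner_Integration.integral_cong) (auto simp: bin_def indicator_def)
  also have "\<dots> = expectation (\<lambda>\<omega>. indicator (bin B) \<omega> *\<^sub>R real_cond_exp M ?F ?f \<omega>)"
    using real_cond_exp_intA[OF _ binF, of ?f] by (simp add: set_lebesgue_integral_def emeasure_eq_measure)
  also have "\<dots> = expectation (\<lambda>\<omega>. indicator B (g (X \<omega>)) * r (g (X \<omega>)) $ y)"
  proof (rule integral_cong_AE)
    have "AE \<omega> in M. r (g (X \<omega>)) $ y = real_cond_exp M ?F ?f \<omega>"
      using calibration unfolding calibration_function_def by blast
    then show "AE \<omega> in M. indicator (bin B) \<omega> *\<^sub>R real_cond_exp M ?F ?f \<omega> =
        indicator B (g (X \<omega>)) * r (g (X \<omega>)) $ y"
      using AE_space by eventually_elim (auto simp: bin_def indicator_def)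
    show "(\<lambda>\<omega>. indicator (bin B) \<omega> *\<^sub>R real_cond_exp M ?F ?f \<omega>) \<in> borel_measurable M"
      using B by (intro borel_measurable_scaleR borel_measurable_indicator bin_in_events
        borel_measurable_cond_exp2)
    show "(\<lambda>\<omega>. indicator B (g (X \<omega>)) * r (g (X \<omega>)) $ y) \<in> borel_measurable M"
      using B measurable_compose[OF measurable_rgX borel_measurable_nth]
        measurable_compose[OF measurable_gX borel_measurable_indicator]
      by (intro borel_measurable_times) auto
  qed
  finally show ?thesis .
qed

section \<open>Almost sure limits of bin frequencies and averages\<close>

lemma bin_count_tendsto:
  assumes "B \<in> sets borel"
  shows "AE \<omega> in M. (\<lambda>n. bin_count n (\<lambda>j. g (Xs j \<omega>)) B / n) \<longlonglongrightarrow> prob (bin B)"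
  using iid_data_average_tendsto[OF iid, of "\<lambda>z. indicator B (g (fst z))" 1] assms
  by (simp add: bin_count_eq_sum prob_bin_eq_expectation indicator_def[of B "g _"])

lemma p_hat_tendsto:
  assumes "A \<in> sets borel" "B \<in> sets borel" "prob (bin A) > 0"
  shows "AE \<omega> in M. (\<lambda>n. p_hat n (\<lambda>j. g (Xs j \<omega>)) A B) \<longlonglongrightarrow> prob (bin B) / prob (bin A)"
  using bin_count_tendsto[OF assms(1)] bin_count_tendsto[OF assms(2)]
proof eventually_elim
  case (elim \<omega>)
  from tendsto_divide[OF elim(2,1)] assms(3)
  have "(\<lambda>n. (bin_count n (\<lambda>j. g (Xs j \<omega>)) B / n) / (bin_count n (\<lambda>j. g (Xs j \<omega>)) A / n))
      \<longlonglongrightarrow> prob (bin B) / prob (bin A)" by simp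
  moreover have "\<forall>\<^sub>F n in sequentially. (bin_count n (\<lambda>j. g (Xs j \<omega>)) B / n) /
      (bin_count n (\<lambda>j. g (Xs j \<omega>)) A / n) = p_hat n (\<lambda>j. g (Xs j \<omega>)) A B"
    using eventually_gt_at_top[of 0] by eventually_elim (simp add: p_hat_def)
  ultimately show ?case
    by (rule Lim_transform_eventually)
qed

text \<open>One statement for both estimators: \<open>h\<close> is a coordinate of \<open>g\<close>
  for \<open>g_hat\<close> and the indicator of a label for \<open>r_hat\<close>. Dividing numerator
  and denominator by \<open>n\<close> turns both into sample averages, and the denominator has a
  positive limit.\<close>

lemma bin_average_tendsto:
  assumes B: "B \<in> sets borel" "prob (bin B) > 0"
    and h: "h \<in> borel_measurable (MX \<Otimes>\<^sub>M count_space UNIV)"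
      "\<And>x y. x \<in> space MX \<Longrightarrow> \<bar>h (x, y)\<bar> \<le> (c::real)"
    and mean: "expectation (\<lambda>\<omega>. indicator B (g (X \<omega>)) * h (X \<omega>, Y \<omega>)) = prob (bin B) * m"
  shows "AE \<omega> in M. (\<lambda>n. (\<Sum>j<n. indicator B (g (Xs j \<omega>)) * h (Xs j \<omega>, Ys j \<omega>)) /
    bin_count n (\<lambda>j. g (Xs j \<omega>)) B) \<longlonglongrightarrow> m"
proof -
  have meas: "(\<lambda>z. indicator B (g (fst z)) * h z) \<in> borel_measurable (MX \<Otimes>\<^sub>M count_space UNIV)"
    using h(1) B(1) by measurable
  have "\<bar>indicator B (g (fst (x, y))) * h (x, y)\<bar> \<le> c" if "x \<in> space MX" for x y
    using h(2)[OF that, of y] by (auto simp: indicator_def)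
  then have "AE \<omega> in M. (\<lambda>n. (\<Sum>j<n. indicator B (g (Xs j \<omega>)) * h (Xs j \<omega>, Ys j \<omega>)) / n)
      \<longlonglongrightarrow> expectation (\<lambda>\<omega>. indicator B (g (X \<omega>)) * h (X \<omega>, Y \<omega>))"
    using iid_data_average_tendsto[OF iid meas, of c] by simp
  from this bin_count_tendsto[OF B(1)] show ?thesis
  proof eventually_elim
    case (elim \<omega>)
    let ?s = "\<lambda>n. \<Sum>j<n. indicator B (g (Xs j \<omega>)) * h (Xs j \<omega>, Ys j \<omega>)"
    have "(\<lambda>n. (?s n / n) / (bin_count n (\<lambda>j. g (Xs j \<omega>)) B / n)) \<longlonglongrightarrow> m"
      using tendsto_divide[OF elim] mean B(2) by simp
    moreover have "\<forall>\<^sub>F n in sequentially. (?s n / n) / (bin_count n (\<lambda>j. g (Xs j \<omega>)) B / n) =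
        ?s n / bin_count n (\<lambda>j. g (Xs j \<omega>)) B"
      using eventually_gt_at_top[of 0] by eventually_elim simp
    ultimately show ?case
      by (rule Lim_transform_eventually)
  qed
qed

lemma bin_mean_nth:
  fixes f :: "'w \<Rightarrow> real ^ 'y"
  assumes "B \<in> sets borel" "f \<in> borel_measurable M" "\<And>\<omega>. \<omega> \<in> space M \<Longrightarrow> f \<omega> \<in> prob_simplex"
  shows "expectation (\<lambda>\<omega>. indicator B (g (X \<omega>)) * f \<omega> $ y) = prob (bin B) * bin_mean B f $ y"
proof -
  have meas: "(\<lambda>\<omega>. indicator B (g (X \<omega>)) *\<^sub>R f \<omega>) \<in> borel_measurable M"
    using assms by measurable
  have "integrable M f"
    using assms compact_prob_simplex by (intro integrable_in_compact[of _ prob_simplex]) auto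
  then have "integrable M (\<lambda>\<omega>. indicator B (g (X \<omega>)) *\<^sub>R f \<omega>)"
    by (rule Bochner_Integration.integrable_bound[OF _ meas]) (auto simp: indicator_def)
  then have "expectation (\<lambda>\<omega>. (indicator B (g (X \<omega>)) *\<^sub>R f \<omega>) $ y) = (prob (bin B) *\<^sub>R bin_mean B f) $ y"
    unfolding prob_times_bin_mean[OF assms(1,2)]
    by (rule integral_bounded_linear[OF bounded_linear_vec_nth])
  then show ?thesis by simp
qed

lemma g_hat_tendsto:
  assumes B: "B \<in> sets borel" "prob (bin B) > 0"
  shows "AE \<omega> in M. (\<lambda>n. g_hat n (\<lambda>j. g (Xs j \<omega>)) B) \<longlonglongrightarrow> bin_mean B (\<lambda>\<omega>. g (X \<omega>))"
proof -
  have "AE \<omega> in M. (\<lambda>n. g_hat n (\<lambda>j. g (Xs j \<omega>)) B $ y) \<longlonglongrightarrow> bin_mean B (\<lambda>\<omega>. g (X \<omega>)) $ y" for y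
  proof -
    have "\<bar>g x $ y\<bar> \<le> 1" if "x \<in> space MX" for x
      using g_in_prob_simplex[OF that] by (auto simp: prob_simplex_def)
    moreover have "(\<lambda>z. g (fst z) $ y) \<in> borel_measurable (MX \<Otimes>\<^sub>M count_space UNIV)"
      using measurable_compose[OF measurable_compose[OF measurable_fst measurable_g] borel_measurable_nth] .
    ultimately show ?thesis
      using bin_average_tendsto[OF B, of "\<lambda>z. g (fst z) $ y" 1, unfolded fst_conv]
        bin_mean_nth[OF B(1) measurable_gX gX_in_prob_simplex]
      unfolding g_hat_nth by blast
  qed
  then have "AE \<omega> in M. \<forall>y. (\<lambda>n. g_hat n (\<lambda>j. g (Xs j \<omega>)) B $ y) \<longlonglongrightarrow> bin_mean B (\<lambda>\<omega>. g (X \<omega>)) $ y"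
    by (subst AE_all_countable) simp
  then show ?thesis
    by eventually_elim (simp add: vec_tendstoI)
qed

lemma r_hat_tendsto:
  assumes B: "B \<in> sets borel" "prob (bin B) > 0"
  shows "AE \<omega> in M. (\<lambda>n. r_hat n (\<lambda>j. g (Xs j \<omega>)) (\<lambda>j. Ys j \<omega>) B) \<longlonglongrightarrow> bin_mean B (\<lambda>\<omega>. r (g (X \<omega>)))"
proof -
  have "AE \<omega> in M. (\<lambda>n. r_hat n (\<lambda>j. g (Xs j \<omega>)) (\<lambda>j. Ys j \<omega>) B $ y) \<longlonglongrightarrow> bin_mean B (\<lambda>\<omega>. r (g (X \<omega>))) $ y" for y
  proof -
    have "(\<lambda>z. indicator {y} (snd z)) \<in> borel_measurable (MX \<Otimes>\<^sub>M count_space UNIV)"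
      by measurable
    moreover have "\<bar>indicator {y} z\<bar> \<le> (1::real)" for z
      by (simp add: indicator_def)
    \<comment> \<open>The sample average of the label indicators tends to the joint probability of
      bin and label, which calibration rewrites as an integral of
      \<open>r (g (X \<omega>))\<close>.\<close>
    moreover have "expectation (\<lambda>\<omega>. indicator B (g (X \<omega>)) * indicator {y} (Y \<omega>)) =
        prob (bin B) * bin_mean B (\<lambda>\<omega>. r (g (X \<omega>))) $ y"
      using bin_mean_nth[OF B(1) measurable_rgX rgX_in_prob_simplex] label_frequency_eq_calibration[OF B(1)]
      by simp
    ultimately show ?thesis
      using bin_average_tendsto[OF B, of "\<lambda>z. indicator {y} (snd z)" 1, unfolded snd_conv]
      unfolding r_hat_nth by blast
  qed
  then have "AE \<omega> in M. \<forall>y. (\<lambda>n. r_hat n (\<lambda>j. g (Xs j \<omega>)) (\<lambda>j. Ys j \<omega>) B $ y) \<longlonglongrightarrow> bin_mean B (\<lambda>\<omega>. r (g (X \<omega>))) $ y"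
    by (subst AE_all_countable) simp
  then show ?thesis
    by eventually_elim (simp add: vec_tendstoI)
qed

lemma prob_space_bin:
  assumes "B \<in> sets borel" "prob (bin B) > 0"
  shows "prob_space (uniform_measure M (bin B))"
  using assms by (intro prob_space_uniform_measure) (auto simp: emeasure_eq_measure)

lemma bin_mean_in_prob_simplex:
  assumes B: "B \<in> sets borel" "prob (bin B) > 0"
    and f: "f \<in> borel_measurable M" "\<And>\<omega>. \<omega> \<in> space M \<Longrightarrow> f \<omega> \<in> prob_simplex"
  shows "bin_mean B f \<in> prob_simplex"
proof -
  interpret N: prob_space "uniform_measure M (bin B)"
    using prob_space_bin[OF B] .
  have "AE \<omega> in uniform_measure M (bin B). f \<omega> \<in> prob_simplex"
    using f by (intro AE_I2) simp
  moreover from this have "integrable (uniform_measure M (bin B)) f"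
    using f compact_prob_simplex by (intro N.integrable_in_compact) auto
  ultimately show ?thesis
    unfolding bin_mean_def using convex_prob_simplex compact_prob_simplex
    by (intro N.mean_in_closed_convex) (auto intro: compact_imp_closed)
qed

lemma rg_hat_in_prob_simplex:
  assumes "bin_count n (\<lambda>j. g (Xs j \<omega>)) B \<noteq> 0" "\<omega> \<in> space M"
  shows "(r_hat n (\<lambda>j. g (Xs j \<omega>)) (\<lambda>j. Ys j \<omega>) B, g_hat n (\<lambda>j. g (Xs j \<omega>)) B) \<in> prob_simplex \<times> prob_simplex"
  using r_hat_in_prob_simplex[OF assms(1)] g_hat_in_prob_simplex[OF assms(1) g_in_prob_simplex]
    Xs_in_space[OF assms(2)] by simp

text \<open>\<open>d\<close> is controlled only on the product of simplices. A bin of positive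
  probability is eventually nonempty, so the estimates lie there and continuity applies. In a null
  bin no convergence of the estimates is used: \<open>d\<close> is bounded on the compact product
  and the weight tends to zero.\<close>

lemma bin_term_tendsto:
  assumes A: "A \<in> sets borel" "prob (bin A) > 0" and B: "B \<in> sets borel"
    and d: "continuous_on (prob_simplex \<times> prob_simplex) d"
  shows "AE \<omega> in M. (\<lambda>n. p_hat n (\<lambda>j. g (Xs j \<omega>)) A B *
      d (r_hat n (\<lambda>j. g (Xs j \<omega>)) (\<lambda>j. Ys j \<omega>) B, g_hat n (\<lambda>j. g (Xs j \<omega>)) B)) \<longlonglongrightarrow>
    prob (bin B) / prob (bin A) * d (bin_mean B (\<lambda>\<omega>. r (g (X \<omega>))), bin_mean B (\<lambda>\<omega>. g (X \<omega>)))"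
proof (cases "prob (bin B) > 0")
  case True
  from p_hat_tendsto[OF A(1) B A(2)] r_hat_tendsto[OF B True] g_hat_tendsto[OF B True]
    bin_count_tendsto[OF B] AE_space
  show ?thesis
  proof eventually_elim
    case (elim \<omega>)
    let ?rg = "\<lambda>n. (r_hat n (\<lambda>j. g (Xs j \<omega>)) (\<lambda>j. Ys j \<omega>) B, g_hat n (\<lambda>j. g (Xs j \<omega>)) B)"
    have "\<forall>\<^sub>F n in sequentially. 0 < bin_count n (\<lambda>j. g (Xs j \<omega>)) B / n"
      using order_tendstoD(1)[OF elim(4) True] .
    then have "\<forall>\<^sub>F n in sequentially. ?rg n \<in> prob_simplex \<times> prob_simplex"
    proof eventually_elim
      case (elim n)
      then have "bin_count n (\<lambda>j. g (Xs j \<omega>)) B \<noteq> 0"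
        by (auto simp: zero_less_divide_iff)
      then show ?case
        using rg_hat_in_prob_simplex \<open>\<omega> \<in> space M\<close> by blast
    qed
    moreover have "(bin_mean B (\<lambda>\<omega>. r (g (X \<omega>))), bin_mean B (\<lambda>\<omega>. g (X \<omega>))) \<in> prob_simplex \<times> prob_simplex"
      using bin_mean_in_prob_simplex[OF B True measurable_rgX rgX_in_prob_simplex]
        bin_mean_in_prob_simplex[OF B True measurable_gX gX_in_prob_simplex] by simp
    ultimately have "(\<lambda>n. d (?rg n)) \<longlonglongrightarrow> d (bin_mean B (\<lambda>\<omega>. r (g (X \<omega>))), bin_mean B (\<lambda>\<omega>. g (X \<omega>)))"
      by (rule continuous_on_tendsto_compose[OF d tendsto_Pair[OF elim(2,3)], rotated])
    with elim(1) show ?case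
      by (rule tendsto_mult)
  qed
next
  case False
  then have 0: "prob (bin B) = 0"
    using measure_nonneg[of M "bin B"] by linarith
  obtain c where c: "\<And>z. z \<in> prob_simplex \<times> prob_simplex \<Longrightarrow> \<bar>d z\<bar> \<le> c"
    using compact_imp_bounded[OF compact_continuous_image[OF d compact_Times[OF compact_prob_simplex compact_prob_simplex]]]
    unfolding bounded_iff real_norm_def by blast
  from p_hat_tendsto[OF A(1) B A(2)] AE_space show ?thesis
  proof eventually_elim
    case (elim \<omega>)
    let ?p = "\<lambda>n. p_hat n (\<lambda>j. g (Xs j \<omega>)) A B"
    let ?d = "\<lambda>n. d (r_hat n (\<lambda>j. g (Xs j \<omega>)) (\<lambda>j. Ys j \<omega>) B, g_hat n (\<lambda>j. g (Xs j \<omega>)) B)"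
    \<comment> \<open>For an empty bin \<open>p_hat\<close> is zero, so the bound holds although the
      estimates are outside the simplex.\<close>
    have "\<bar>?p n * ?d n\<bar> \<le> ?p n * c" for n
    proof (cases "bin_count n (\<lambda>j. g (Xs j \<omega>)) B = 0")
      case False
      have "0 \<le> ?p n"
        by (simp add: p_hat_def)
      with mult_left_mono[OF c[OF rg_hat_in_prob_simplex[OF False elim(2)]] this] show ?thesis
        by (simp only: abs_mult abs_of_nonneg)
    qed (simp add: p_hat_def)
    moreover have "(\<lambda>n. ?p n * c) \<longlonglongrightarrow> 0"
      using tendsto_mult_right[OF elim(1), of c] by (simp add: 0)
    ultimately have "(\<lambda>n. ?p n * ?d n) \<longlonglongrightarrow> 0"
      by (intro Lim_null_comparison[of "\<lambda>n. ?p n * ?d n" "\<lambda>n. ?p n * c"])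
        (simp_all only: real_norm_def eventually_True)
    then show ?case
      by (simp add: 0)
  qed
qed

section \<open>Jensen's inequality and total expectation over the bins\<close>

lemma measurable_d:
  assumes "continuous_on (prob_simplex \<times> prob_simplex) d"
  shows "(\<lambda>\<omega>. d (r (g (X \<omega>)), g (X \<omega>))) \<in> borel_measurable M"
proof (rule measurable_compose[where N = "restrict_space borel (prob_simplex \<times> prob_simplex)"])
  show "(\<lambda>\<omega>. (r (g (X \<omega>)), g (X \<omega>))) \<in> M \<rightarrow>\<^sub>M restrict_space borel (prob_simplex \<times> prob_simplex)"
    using measurable_rgX measurable_gX rgX_in_prob_simplex gX_in_prob_simplex
    by (intro measurable_restrict_space2) (auto simp: borel_prod[symmetric])
  show "d \<in> borel_measurable (restrict_space borel (prob_simplex \<times> prob_simplex))"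
    using assms by (rule borel_measurable_continuous_on_restrict)
qed

lemma integrable_bin:
  assumes "B \<in> sets borel" "prob (bin B) > 0"
    and "f \<in> borel_measurable M" "\<And>\<omega>. \<omega> \<in> space M \<Longrightarrow> f \<omega> \<in> prob_simplex"
  shows "integrable (uniform_measure M (bin B)) f"
proof -
  interpret N: prob_space "uniform_measure M (bin B)"
    using prob_space_bin[OF assms(1,2)] .
  show ?thesis
    using assms compact_prob_simplex
    by (intro N.integrable_in_compact[of _ prob_simplex]) (auto intro: AE_I2)
qed

lemma bin_mean_pair:
  assumes "B \<in> sets borel" "prob (bin B) > 0"
  shows "bin_mean B (\<lambda>\<omega>. (r (g (X \<omega>)), g (X \<omega>))) =
    (bin_mean B (\<lambda>\<omega>. r (g (X \<omega>))), bin_mean B (\<lambda>\<omega>. g (X \<omega>)))"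
proof -
  interpret N: prob_space "uniform_measure M (bin B)"
    using prob_space_bin[OF assms] .
  show ?thesis
    unfolding bin_mean_def
    by (intro N.expectation_Pair_euclidean integrable_bin[OF assms]
      measurable_rgX rgX_in_prob_simplex measurable_gX gX_in_prob_simplex)
qed

lemma bin_mean_difference:
  assumes "B \<in> sets borel" "prob (bin B) > 0"
  shows "bin_mean B (\<lambda>\<omega>. r (g (X \<omega>)) - g (X \<omega>)) =
    bin_mean B (\<lambda>\<omega>. r (g (X \<omega>))) - bin_mean B (\<lambda>\<omega>. g (X \<omega>))"
  unfolding bin_mean_def
  by (intro Bochner_Integration.integral_diff integrable_bin[OF assms]
    measurable_rgX rgX_in_prob_simplex measurable_gX gX_in_prob_simplex)

lemma d_bin_mean_le:
  assumes B: "B \<in> sets borel" "prob (bin B) > 0"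
    and d: "continuous_on (prob_simplex \<times> prob_simplex) d" "convex_on (prob_simplex \<times> prob_simplex) d"
  shows "d (bin_mean B (\<lambda>\<omega>. r (g (X \<omega>))), bin_mean B (\<lambda>\<omega>. g (X \<omega>))) \<le>
    bin_mean B (\<lambda>\<omega>. d (r (g (X \<omega>)), g (X \<omega>)))"
proof -
  interpret N: prob_space "uniform_measure M (bin B)"
    using prob_space_bin[OF B] .
  have "d (bin_mean B (\<lambda>\<omega>. (r (g (X \<omega>)), g (X \<omega>)))) \<le> bin_mean B (\<lambda>\<omega>. d (r (g (X \<omega>)), g (X \<omega>)))"
    unfolding bin_mean_def
  proof (rule N.jensens_inequality_compact)
    show "AE \<omega> in uniform_measure M (bin B). (r (g (X \<omega>)), g (X \<omega>)) \<in> prob_simplex \<times> prob_simplex"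
      by (intro AE_I2) (simp add: rgX_in_prob_simplex gX_in_prob_simplex)
    show "(\<lambda>\<omega>. (r (g (X \<omega>)), g (X \<omega>))) \<in> borel_measurable (uniform_measure M (bin B))"
      using measurable_rgX measurable_gX by (simp add: borel_prod[symmetric])
    show "(\<lambda>\<omega>. d (r (g (X \<omega>)), g (X \<omega>))) \<in> borel_measurable (uniform_measure M (bin B))"
      using measurable_d[OF d(1)] by simp
  qed (simp_all add: d compact_Times compact_prob_simplex)
  then show ?thesis
    by (simp add: bin_mean_pair[OF B])
qed

lemma miscalibration_estimator_tendsto:
  assumes "A \<in> sets borel" "prob (bin A) > 0" "finite \<Phi>" "\<Phi> \<subseteq> sets borel"
    and "continuous_on (prob_simplex \<times> prob_simplex) d"
  shows "AE \<omega> in M. (\<lambda>n. miscalibration_estimator A \<Phi> d n (\<lambda>j. g (Xs j \<omega>)) (\<lambda>j. Ys j \<omega>)) \<longlonglongrightarrow>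
    (\<Sum>B\<in>\<Phi>. prob (bin B) / prob (bin A) *
      d (bin_mean B (\<lambda>\<omega>. r (g (X \<omega>))), bin_mean B (\<lambda>\<omega>. g (X \<omega>))))"
proof -
  have "AE \<omega> in M. \<forall>B\<in>\<Phi>. (\<lambda>n. p_hat n (\<lambda>j. g (Xs j \<omega>)) A B *
      d (r_hat n (\<lambda>j. g (Xs j \<omega>)) (\<lambda>j. Ys j \<omega>) B, g_hat n (\<lambda>j. g (Xs j \<omega>)) B)) \<longlonglongrightarrow>
    prob (bin B) / prob (bin A) * d (bin_mean B (\<lambda>\<omega>. r (g (X \<omega>))), bin_mean B (\<lambda>\<omega>. g (X \<omega>)))"
    using assms by (intro AE_finite_allI bin_term_tendsto) auto
  then show ?thesis
    unfolding miscalibration_estimator_def by eventually_elim (intro tendsto_sum, blast)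
qed

text \<open>Total expectation: the indicator of \<open>A\<close> is the sum of the indicators of the
  bins, so the integral over \<open>A\<close> splits. The product form of
  \<open>prob_times_bin_mean\<close> admits null bins.\<close>

lemma expected_miscalibration_eq_sum:
  assumes A: "prob (bin A) > 0" "finite \<Phi>" "\<Phi> \<subseteq> sets borel" "partition_on A \<Phi>"
    and d: "continuous_on (prob_simplex \<times> prob_simplex) d"
  shows "expected_miscalibration M g X r A d =
    (\<Sum>B\<in>\<Phi>. prob (bin B) / prob (bin A) * bin_mean B (\<lambda>\<omega>. d (r (g (X \<omega>)), g (X \<omega>))))"
proof -
  let ?d = "\<lambda>\<omega>. d (r (g (X \<omega>)), g (X \<omega>))"
  have union: "\<Union>\<Phi> = A" and disj: "disjoint \<Phi>"
    using A(4) by (auto simp: partition_on_def)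
  have Ab: "A \<in> sets borel"
    using union A(2,3) by blast
  note meas = measurable_d[OF d]
  have int: "integrable M ?d"
    using rgX_in_prob_simplex gX_in_prob_simplex
    by (intro integrable_in_compact[OF meas _ compact_continuous_image[OF d compact_Times[OF compact_prob_simplex compact_prob_simplex]]])
      (auto intro!: AE_I2)
  have indA: "indicator A x = (\<Sum>B\<in>\<Phi>. indicator B x :: real)" for x
    using indicator_UN_disjoint[OF A(2), of "\<lambda>B. B" x] disj union
    by (simp add: disjoint_family_on_def disjoint_def)
  have intB: "integrable M (\<lambda>\<omega>. indicator B (g (X \<omega>)) *\<^sub>R ?d \<omega>)" if "B \<in> \<Phi>" for B
  proof (rule Bochner_Integration.integrable_bound[OF int])
    show "(\<lambda>\<omega>. indicator B (g (X \<omega>)) *\<^sub>R ?d \<omega>) \<in> borel_measurable M"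
      using that A(3) meas measurable_compose[OF measurable_gX borel_measurable_indicator, of B]
      by (intro borel_measurable_scaleR) auto
  qed (auto simp: indicator_def)
  have "prob (bin A) *\<^sub>R bin_mean A ?d = expectation (\<lambda>\<omega>. indicator A (g (X \<omega>)) *\<^sub>R ?d \<omega>)"
    by (rule prob_times_bin_mean[OF Ab meas])
  also have "\<dots> = expectation (\<lambda>\<omega>. \<Sum>B\<in>\<Phi>. indicator B (g (X \<omega>)) *\<^sub>R ?d \<omega>)"
    by (simp only: indA scaleR_sum_left)
  also have "\<dots> = (\<Sum>B\<in>\<Phi>. expectation (\<lambda>\<omega>. indicator B (g (X \<omega>)) *\<^sub>R ?d \<omega>))"
    using intB by (rule Bochner_Integration.integral_sum)
  also have "\<dots> = (\<Sum>B\<in>\<Phi>. prob (bin B) *\<^sub>R bin_mean B ?d)"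
    using A(3) by (intro sum.cong refl prob_times_bin_mean[OF _ meas, symmetric]) auto
  finally have "prob (bin A) * bin_mean A ?d = (\<Sum>B\<in>\<Phi>. prob (bin B) * bin_mean B ?d)"
    by simp
  moreover have "expected_miscalibration M g X r A d = bin_mean A ?d"
    by (simp add: expected_miscalibration_def bin_mean_def bin_def)
  ultimately show ?thesis
    using A(1) by (simp add: sum_divide_distrib[symmetric] field_simps)
qed

section \<open>The equality case in a bin\<close>

text \<open>Passing to the difference \<open>?V\<close> expresses both sides of the equation by
  \<open>f\<close> and the law of \<open>?V\<close> on the compact convex set \<open>?D\<close>,
  where the two directions of the equality case of Jensen's inequality apply.\<close>

lemma d_bin_mean_eq_iff_affine:
  assumes B: "B \<in> sets borel" "prob (bin B) > 0"
    and d: "continuous_on (prob_simplex \<times> prob_simplex) d"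
    and f: "convex_on {p - p' | p p'. p \<in> prob_simplex \<and> p' \<in> prob_simplex} f"
      "\<And>p p'. p \<in> prob_simplex \<Longrightarrow> p' \<in> prob_simplex \<Longrightarrow> d (p, p') = f (p - p')"
  shows "d (bin_mean B (\<lambda>\<omega>. r (g (X \<omega>))), bin_mean B (\<lambda>\<omega>. g (X \<omega>))) =
      bin_mean B (\<lambda>\<omega>. d (r (g (X \<omega>)), g (X \<omega>))) \<longleftrightarrow>
    (\<exists>S. \<P>(\<omega> in M. r (g (X \<omega>)) - g (X \<omega>) \<in> S \<bar> g (X \<omega>) \<in> B) = 1 \<and>
      (\<exists>a b. \<forall>x \<in> convex hull S. f x = a \<bullet> x + b))"
    (is "?eq \<longleftrightarrow> ?affine")
proof -
  let ?D = "{p - p' | p p'. p \<in> prob_simplex \<and> p' \<in> prob_simplex} :: (real ^ 'y) set"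
  let ?N = "uniform_measure M (bin B)"
  let ?V = "\<lambda>\<omega>. r (g (X \<omega>)) - g (X \<omega>)"
  interpret N: prob_space ?N
    using prob_space_bin[OF B] .
  have D: "compact ?D" "convex ?D"
    using compact_differences[OF compact_prob_simplex compact_prob_simplex]
      f(1) convex_on_imp_convex by blast+
  \<comment> \<open>\<open>f\<close> is not assumed continuous; subtraction maps the compact product
    onto \<open>?D\<close>, so continuity of \<open>d\<close> passes to \<open>f\<close>.\<close>
  have "?D = (\<lambda>(p, p'). p - p') ` (prob_simplex \<times> prob_simplex)"
    by auto
  moreover have "continuous_on ((\<lambda>(p, p'). p - p') ` (prob_simplex \<times> prob_simplex)) f"
  proof (rule continuous_on_compact_quotient)
    show "continuous_on (prob_simplex \<times> prob_simplex) (\<lambda>z :: (real ^ 'y) \<times> (real ^ 'y). case z of (p, p') \<Rightarrow> p - p')"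
      by (auto simp: split_beta intro!: continuous_intros)
    show "continuous_on (prob_simplex \<times> prob_simplex) (\<lambda>z. f (case z of (p, p') \<Rightarrow> p - p'))"
      using d by (rule continuous_on_eq) (auto simp: f(2))
  qed (intro compact_Times compact_prob_simplex)
  ultimately have cont: "continuous_on ?D f"
    by simp
  have dfV: "d (r (g (X \<omega>)), g (X \<omega>)) = f (?V \<omega>)" if "\<omega> \<in> space M" for \<omega>
    using that by (simp add: f(2) rgX_in_prob_simplex gX_in_prob_simplex)
  have V: "?V \<in> borel_measurable M"
    using measurable_rgX measurable_gX by simp
  then have VN: "?V \<in> borel_measurable ?N"
    by simp
  have "(\<lambda>\<omega>. f (?V \<omega>)) \<in> borel_measurable M"
    using measurable_d[OF d] dfV by (simp cong: measurable_cong)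
  then have fV: "(\<lambda>\<omega>. f (?V \<omega>)) \<in> borel_measurable ?N"
    by simp
  have VD: "AE \<omega> in ?N. ?V \<omega> \<in> ?D"
    using rgX_in_prob_simplex gX_in_prob_simplex by (intro AE_I2) auto
  have bin: "{\<omega> \<in> space M. g (X \<omega>) \<in> B} \<in> events" "prob {\<omega> \<in> space M. g (X \<omega>) \<in> B} > 0"
    using B bin_in_events unfolding bin_def by auto
  have "bin_mean B (\<lambda>\<omega>. d (r (g (X \<omega>)), g (X \<omega>))) = N.expectation (\<lambda>\<omega>. f (?V \<omega>))"
    unfolding bin_mean_def using dfV by (intro Bochner_Integration.integral_cong) auto
  moreover have "d (bin_mean B (\<lambda>\<omega>. r (g (X \<omega>))), bin_mean B (\<lambda>\<omega>. g (X \<omega>))) = f (N.expectation ?V)"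
    unfolding bin_mean_difference[OF B, unfolded bin_mean_def[of B ?V]]
    by (intro f(2) bin_mean_in_prob_simplex[OF B] measurable_rgX measurable_gX
      rgX_in_prob_simplex gX_in_prob_simplex)
  ultimately have "?eq \<longleftrightarrow> N.expectation (\<lambda>\<omega>. f (?V \<omega>)) = f (N.expectation ?V)"
    by auto
  also have "\<dots> \<longleftrightarrow> ?affine"
  proof
    assume "N.expectation (\<lambda>\<omega>. f (?V \<omega>)) = f (N.expectation ?V)"
    then obtain S a b where S: "convex S" "compact S" "AE \<omega> in ?N. ?V \<omega> \<in> S"
      and ab: "\<And>x. x \<in> S \<Longrightarrow> f x = a \<bullet> x + b"
      using N.jensens_equality_affine[OF VN VD fV D(1) cont f(1)] by blast
    \<comment> \<open>Almost sure membership is turned into conditional probability 1 for a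
      measurable event, and a compact \<open>S\<close> is Borel.\<close>
    have "{\<omega> \<in> space M. ?V \<omega> \<in> S} \<in> events"
      using measurable_sets[OF V, of S] S(2)
      by (simp add: vimage_def Int_def conj_commute borel_compact)
    then have "\<P>(\<omega> in M. ?V \<omega> \<in> S \<bar> g (X \<omega>) \<in> B) = 1"
      by (rule cond_prob_eq_1_if_AE_uniform_measure[OF bin _ S(3)[unfolded bin_def]])
    moreover have "\<forall>x \<in> convex hull S. f x = a \<bullet> x + b"
      using ab S(1) by (simp add: convex_hull_eq[THEN iffD2])
    ultimately show ?affine
      by blast
  next
    assume ?affine
    then obtain S a b where S: "\<P>(\<omega> in M. ?V \<omega> \<in> S \<bar> g (X \<omega>) \<in> B) = 1"
      and ab: "\<And>x. x \<in> convex hull S \<Longrightarrow> f x = a \<bullet> x + b"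
      by blast
    have "AE \<omega> in ?N. ?V \<omega> \<in> S"
      using AE_uniform_measure_if_cond_prob_eq_1[OF bin S] unfolding bin_def .
    then show "N.expectation (\<lambda>\<omega>. f (?V \<omega>)) = f (N.expectation ?V)"
      using N.jensens_equality_if_affine[OF VN VD D(1) cont D(2) fV _ ab] by blast
  qed
  finally show ?thesis .
qed

end

section \<open>The limit of the estimator compared with the expected miscalibration\<close>

theorem theorem2:
  fixes M :: "'w measure" and MX :: "'x measure"
    and X :: "'w \<Rightarrow> 'x" and Y :: "'w \<Rightarrow> 'y::finite"
    and Xs :: "nat \<Rightarrow> 'w \<Rightarrow> 'x" and Ys :: "nat \<Rightarrow> 'w \<Rightarrow> 'y"
    and g :: "'x \<Rightarrow> real ^ 'y" and r :: "real ^ 'y \<Rightarrow> real ^ 'y"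
    and A :: "(real ^ 'y) set" and \<Phi> :: "(real ^ 'y) set set"
    and d :: "(real ^ 'y) \<times> (real ^ 'y) \<Rightarrow> real"
  defines "\<eta> \<equiv> expected_miscalibration M g X r A d"
    and "\<eta>_hat \<equiv> \<lambda>n \<omega>. miscalibration_estimator A \<Phi> d n (\<lambda>j. g (Xs j \<omega>)) (\<lambda>j. Ys j \<omega>)"
  assumes "prob_space M"
    and "iid_data M MX X Y Xs Ys"
    and "g \<in> MX \<rightarrow>\<^sub>M simplex_borel"
    and "calibration_function M g X Y r"
    and "A \<subseteq> prob_simplex"
    and "\<P>(\<omega> in M. g (X \<omega>) \<in> A) > 0"
    and "finite \<Phi>" and "partition_on A \<Phi>" and "\<Phi> \<subseteq> sets borel"
    and "continuous_on (prob_simplex \<times> prob_simplex) d"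
    and "convex_on (prob_simplex \<times> prob_simplex) d"
    and "\<forall>z \<in> prob_simplex \<times> prob_simplex. d z \<ge> 0"
  shows "(AE \<omega> in M. convergent (\<lambda>n. \<eta>_hat n \<omega>) \<and> lim (\<lambda>n. \<eta>_hat n \<omega>) \<le> \<eta>) \<and>
    (\<forall>f. convex_on {p - p' | p p'. p \<in> prob_simplex \<and> p' \<in> prob_simplex} f \<and>
         (\<forall>p\<in>prob_simplex. \<forall>p'\<in>prob_simplex. d (p, p') = f (p - p')) \<longrightarrow>
       ((AE \<omega> in M. lim (\<lambda>n. \<eta>_hat n \<omega>) = \<eta>) \<longleftrightarrow>
        (\<forall>B\<in>\<Phi>. \<P>(\<omega> in M. g (X \<omega>) \<in> B) > 0 \<longrightarrow>
           (\<exists>S. \<P>(\<omega> in M. r (g (X \<omega>)) - g (X \<omega>) \<in> S \<bar> g (X \<omega>) \<in> B) = 1 \<and>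
                (\<exists>a b. \<forall>x \<in> convex hull S. f x = a \<bullet> x + b)))))"
proof -
  interpret calibrated_data M MX X Y Xs Ys g r
    using assms(3-6) by (simp add: calibrated_data_def calibrated_data_axioms_def)
  have A: "prob (bin A) > 0" "A \<in> sets borel"
    using assms(8-11) by (auto simp: bin_def partition_on_def)
  have B: "B \<in> sets borel" if "B \<in> \<Phi>" for B
    using that assms(11) by blast
  \<comment> \<open>\<open>L\<close> will be the limit of the estimator: \<open>w\<close> weighs the
    bins within \<open>A\<close>, and \<open>l\<close> and \<open>u\<close> are the two sides of
    Jensen's inequality in a bin.\<close>
  define w where "w B = prob (bin B) / prob (bin A)" for B
  define l where "l B = d (bin_mean B (\<lambda>\<omega>. r (g (X \<omega>))), bin_mean B (\<lambda>\<omega>. g (X \<omega>)))" for B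
  define u where "u B = bin_mean B (\<lambda>\<omega>. d (r (g (X \<omega>)), g (X \<omega>)))" for B
  define L where "L = (\<Sum>B\<in>\<Phi>. w B * l B)"
  have \<eta>: "\<eta> = (\<Sum>B\<in>\<Phi>. w B * u B)"
    unfolding \<eta>_def w_def u_def using assms A by (intro expected_miscalibration_eq_sum) auto
  have term_le: "w B * l B \<le> w B * u B" if "B \<in> \<Phi>" for B
  proof (cases "prob (bin B) > 0")
    case True
    then have "l B \<le> u B"
      unfolding l_def u_def using B[OF that] assms(12,13) by (intro d_bin_mean_le)
    then show ?thesis
      by (intro mult_left_mono) (simp_all add: w_def)
  next
    case False
    then show ?thesis
      using measure_nonneg[of M "bin B"] by (simp add: w_def less_eq_real_def)
  qed
  have L: "L \<le> \<eta>"
    unfolding L_def \<eta> by (intro sum_mono term_le)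
  have lim: "AE \<omega> in M. (\<lambda>n. \<eta>_hat n \<omega>) \<longlonglongrightarrow> L"
    unfolding \<eta>_hat_def L_def w_def l_def using assms A
    by (intro miscalibration_estimator_tendsto) auto
  then have "AE \<omega> in M. convergent (\<lambda>n. \<eta>_hat n \<omega>) \<and> lim (\<lambda>n. \<eta>_hat n \<omega>) \<le> \<eta>"
    by eventually_elim (use L in \<open>auto simp: limI convergentI\<close>)
  moreover
  have "(AE \<omega> in M. lim (\<lambda>n. \<eta>_hat n \<omega>) = \<eta>) \<longleftrightarrow>
        (\<forall>B\<in>\<Phi>. \<P>(\<omega> in M. g (X \<omega>) \<in> B) > 0 \<longrightarrow>
           (\<exists>S. \<P>(\<omega> in M. r (g (X \<omega>)) - g (X \<omega>) \<in> S \<bar> g (X \<omega>) \<in> B) = 1 \<and>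
                (\<exists>a b. \<forall>x \<in> convex hull S. f x = a \<bullet> x + b)))"
    if f: "convex_on {p - p' | p p'. p \<in> prob_simplex \<and> p' \<in> prob_simplex} f"
      "\<forall>p\<in>prob_simplex. \<forall>p'\<in>prob_simplex. d (p, p') = f (p - p')" for f
  proof -
    \<comment> \<open>Both \<open>L\<close> and \<open>\<eta>\<close> are constants, so almost sure
      equality becomes the plain equality \<open>L = \<eta>\<close>.\<close>
    have "(AE \<omega> in M. lim (\<lambda>n. \<eta>_hat n \<omega>) = \<eta>) \<longleftrightarrow> (AE \<omega> in M. L = \<eta>)"
      by (rule eventually_subst) (use lim in \<open>eventually_elim, simp add: limI\<close>)
    also have "\<dots> \<longleftrightarrow> L = \<eta>"
      by simp
    also have "\<dots> \<longleftrightarrow> (\<forall>B\<in>\<Phi>. w B * l B = w B * u B)"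
      unfolding L_def \<eta> using sum_mono_inv[of "\<lambda>B. w B * l B" \<Phi> "\<lambda>B. w B * u B"] term_le assms(9)
      by (auto intro: sum.cong)
    \<comment> \<open>A null bin has weight zero and satisfies the equation for free, which explains
      the restriction to bins of positive probability.\<close>
    also have "\<dots> \<longleftrightarrow> (\<forall>B\<in>\<Phi>. prob (bin B) > 0 \<longrightarrow> l B = u B)"
      using A(1) by (auto simp: w_def zero_less_measure_iff)
    also have "\<dots> \<longleftrightarrow> (\<forall>B\<in>\<Phi>. prob (bin B) > 0 \<longrightarrow>
        (\<exists>S. \<P>(\<omega> in M. r (g (X \<omega>)) - g (X \<omega>) \<in> S \<bar> g (X \<omega>) \<in> B) = 1 \<and>
             (\<exists>a b. \<forall>x \<in> convex hull S. f x = a \<bullet> x + b)))"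
      unfolding l_def u_def
      using f B assms(12) by (intro ball_cong imp_cong refl d_bin_mean_eq_iff_affine) auto
    finally show ?thesis
      unfolding bin_def .
  qed
  ultimately show ?thesis
    by blast
qed

end
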